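(* Let $D_1 \subseteq \mathbb{C}^n$ be a bounded open convex set and let $a \in D_1$. Then there exist constants $\alpha \geq 1$, depending only on $D_1$, and $C > 0$, depending only on $D_1$ and $a$, such that the following holds: for every open convex set $D_2 \subseteq \mathbb{C}^m$, every $b \in D_2$, every holomorphic map $\phi : D_1 \to D_2$ with $\phi(a) = b$, and every $r > 0$, $$\mathrm{dist}\big( \phi ( \{ z \in D_1 \mid \mathrm{dist}(z,D_1^{\mathsf{c}}) \geq r \} ),\, D_2^{\mathsf{c}} \big) \;\geq\; C \, \mathrm{dist}(b,D_2^{\mathsf{c}}) \, r^{\alpha}.$$ Moreover, when $\partial D_1$ is $\mathcal{C}^2$-smooth, one can take $\alpha = 1$ in this inequality (that is, there exists a constant $C>0$ depending only on $D_1$ and $a$ such that, for every open convex set $D_2 \subseteq \mathbb{C}^m$, every $b \in D_2$, every holomorphic map $\phi : D_1 \to D_2$ with $\phi(a) = b$, and every $r > 0$, one has $\mathrm{dist}\big( \phi ( \{ z \in D_1 \mid \mathrm{dist}(z,D_1^{\mathsf{c}}) \geq r \} ),\, D_2^{\mathsf{c}} \big) \geq C \, \mathrm{dist}(b,D_2^{\mathsf{c}}) \, r$).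
   Context: $\|\cdot\|$ is the Euclidean norm. For $D \subseteq \mathbb{C}^k$, $D^{\mathsf{c}} = \mathbb{C}^k \setminus D$. For a point $x$ and a set $S$, $\mathrm{dist}(x,S) = \inf_{s \in S}\|x-s\|$, and for sets $A, S$, $\mathrm{dist}(A,S) = \inf_{x\in A,\, s \in S}\|x-s\|$. An infimum over the empty set is $+\infty$ (so the inequality is trivially true if $D_2 = \mathbb{C}^m$ or if $\{ z \in D_1 \mid \mathrm{dist}(z,D_1^{\mathsf{c}}) \geq r \}$ is empty). *)

theory Defs
  imports "HOL-Analysis.Analysis"
begin

(* The constants of the theorem must not depend on the dimension m of the target, so m has to be
   quantified inside the statement.  C^m is therefore a carrier set of sequences supported on
   {..<m}, as in the library's Euclidean_space.  The type class instances of nat => complex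
   (product topology, Function_Metric) are not used: metric and topology are cdist and ctop. *)

definition Cspace :: "nat \<Rightarrow> (nat \<Rightarrow> complex) set" where
  "Cspace m = {x. \<forall>i\<ge>m. x i = 0}"

definition cdist :: "nat \<Rightarrow> (nat \<Rightarrow> complex) \<Rightarrow> (nat \<Rightarrow> complex) \<Rightarrow> real" where
  "cdist m x y = L2_set (\<lambda>i. cmod (x i - y i)) {..<m}"

definition ctop :: "nat \<Rightarrow> (nat \<Rightarrow> complex) topology" where
  "ctop m = Metric_space.mtopology (Cspace m) (cdist m)"

definition cconvex :: "(nat \<Rightarrow> complex) set \<Rightarrow> bool" where
  "cconvex D \<longleftrightarrow> (\<forall>x\<in>D. \<forall>y\<in>D. \<forall>t\<in>{0..1::real}.
     (\<lambda>i. of_real (1 - t) * x i + of_real t * y i) \<in> D)"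

lemma Metric_space_Cspace: "Metric_space (Cspace m) (cdist m)"
proof
  fix x y z :: "nat \<Rightarrow> complex"
  show "0 \<le> cdist m x y"
    by (simp add: cdist_def)
  show "cdist m x y = cdist m y x"
    by (simp add: cdist_def norm_minus_commute)
  show "cdist m x y = 0 \<longleftrightarrow> x = y" if "x \<in> Cspace m" "y \<in> Cspace m"
    using that
    by (simp add: cdist_def Cspace_def L2_set_eq_0_iff fun_eq_iff) (metis lessThan_iff not_le)
  have "cdist m x z \<le> L2_set (\<lambda>i. cmod (x i - y i) + cmod (y i - z i)) {..<m}"
    unfolding cdist_def
    by (rule L2_set_mono) (auto intro: norm_diff_triangle_le)
  also have "\<dots> \<le> cdist m x y + cdist m y z"
    unfolding cdist_def by (rule L2_set_triangle_ineq)
  finally show "cdist m x z \<le> cdist m x y + cdist m y z" .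
qed

(* Unlike infdist and setdist, the value is infinite when one of the sets is empty. *)
definition edist_sets :: "('a \<Rightarrow> 'a \<Rightarrow> real) \<Rightarrow> 'a set \<Rightarrow> 'a set \<Rightarrow> ennreal" where
  "edist_sets d A S = (INF x\<in>A. INF s\<in>S. ennreal (d x s))"

(* Holomorphy on an open subset of C^n: existence at every point of a Frechet derivative that is
   complex linear. *)
definition holomorphic_several :: "(complex^'n \<Rightarrow> complex) \<Rightarrow> (complex^'n) set \<Rightarrow> bool" where
  "holomorphic_several f D \<longleftrightarrow>
     (\<forall>z\<in>D. \<exists>L. (f has_derivative L) (at z) \<and> Vector_Spaces.linear (*s) (*) L)"

definition holomorphic_map ::
  "nat \<Rightarrow> (complex^'n \<Rightarrow> nat \<Rightarrow> complex) \<Rightarrow> (complex^'n) set \<Rightarrow> (nat \<Rightarrow> complex) set \<Rightarrow> bool" where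
  "holomorphic_map m \<phi> D1 D2 \<longleftrightarrow>
     \<phi> \<in> D1 \<rightarrow> D2 \<and> (\<forall>i<m. holomorphic_several (\<lambda>z. \<phi> z i) D1)"

(* The boundary is C^2-smooth: near each boundary point D is the sublevel set {rho < 0} of a
   real-valued C^2 function rho with nowhere vanishing differential rho'. *)
definition C2_boundary :: "('a::real_normed_vector) set \<Rightarrow> bool" where
  "C2_boundary D \<longleftrightarrow> (\<forall>p\<in>frontier D. \<exists>U. open U \<and> p \<in> U \<and>
     (\<exists>(\<rho> :: 'a \<Rightarrow> real) (\<rho>' :: 'a \<Rightarrow> 'a \<Rightarrow>\<^sub>L real) (\<rho>'' :: 'a \<Rightarrow> 'a \<Rightarrow>\<^sub>L 'a \<Rightarrow>\<^sub>L real).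
        (\<forall>x\<in>U. (\<rho> has_derivative blinfun_apply (\<rho>' x)) (at x)) \<and>
        (\<forall>x\<in>U. (\<rho>' has_derivative blinfun_apply (\<rho>'' x)) (at x)) \<and>
        continuous_on U \<rho>'' \<and>
        (\<forall>x\<in>U. \<rho>' x \<noteq> 0) \<and>
        D \<inter> U = {x\<in>U. \<rho> x < 0}))"

end

theory Submission
  imports Defs "HOL-Complex_Analysis.Conformal_Mappings"
begin

text \<open>
  Everything reduces to one scalar function. Let \<open>w\<close> lie outside \<open>D2\<close>. A hyperplane separating
  \<open>w\<close> from the convex set \<open>D2\<close> gives a unit vector \<open>u\<close> such that \<open>F z = \<langle>w - \<phi> z, u\<rangle>\<close> is holomorphic
  with positive real part. Two comparisons with distances hold: \<open>Re (F z) \<le> |w - \<phi> z|\<close> by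
  Cauchy-Schwarz, and \<open>Re (F a)\<close> is at least the distance from \<open>b\<close> to the complement of \<open>D2\<close>,
  because moving \<open>b\<close> by \<open>Re (F a)\<close> in the direction \<open>u\<close> reaches the hyperplane. Hence every Harnack
  inequality \<open>c * Re (F a) \<le> Re (F z)\<close>, valid for all holomorphic \<open>F\<close> with positive real part on
  \<open>D1\<close>, becomes \<open>c * dist(b, complement of D2) \<le> dist(\<phi> z, complement of D2)\<close>, where \<open>c\<close>
  is independent of \<open>D2\<close>, \<open>\<phi>\<close> and the dimension \<open>m\<close>. This is \<open>harnack_transfer\<close>. The hyperplane
  is found by a nearest-point argument for points \<open>w + s (w - b)\<close>, which have positive distance
  from \<open>D2\<close>; then \<open>s\<close> tends to zero.

  It remains to bound \<open>Re (F z) / Re (F a)\<close> from below when a ball of radius \<open>r\<close> around \<open>z\<close> lies in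
  \<open>D1\<close>. The Schwarz lemma gives Harnack's inequality on balls. In a convex domain, the segment from
  \<open>z\<close> to \<open>a\<close> is covered by balls whose radii grow geometrically away from \<open>z\<close>, so that about
  \<open>log (1 / r)\<close> steps suffice, each costing a factor 3: the result is a power of \<open>r\<close>
  (\<open>harnack_convex\<close>). The exponent comes from one fixed base point; changing the base point to \<open>a\<close>
  changes only the factor \<open>C\<close>.

  When the boundary is \<open>C\<^sup>2\<close>, a second-order Taylor estimate and compactness give a radius \<open>\<epsilon>\<close>
  such that, wherever some ball inside \<open>D1\<close> touches the boundary, a ball of radius \<open>\<epsilon>\<close> inside
  \<open>D1\<close> touches it at the same point with the same normal
  (\<open>C2_boundary_interior_ball\<close>). A point \<open>z\<close> close to the boundary is the centre of a ball that
  touches the boundary at the nearest boundary point, so \<open>z\<close> lies on a radius of such a ball of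
  radius \<open>\<epsilon>\<close>, and a single application of Harnack's inequality on the larger ball loses a factor
  that is linear in the distance to the boundary (\<open>harnack_C2\<close>). The centre of the ball has distance at least \<open>\<epsilon>\<close> from the boundary, where the power
  bound is a constant.
\<close>

section \<open>Harnack's inequality on balls\<close>

text \<open>
  The Cayley transform sending \<open>f 0\<close> to 0 turns the right half-plane into the unit disc, and the
  Schwarz lemma applies to the composition. Forgetting the imaginary parts in the resulting
  inequality leaves the bound on the real part.
\<close>

lemma harnack_unit_disc:
  assumes holf: "f holomorphic_on ball 0 1"
    and pos: "\<And>\<zeta>. norm \<zeta> < 1 \<Longrightarrow> Re (f \<zeta>) > 0"
    and \<zeta>: "norm \<zeta> < 1"
  shows "(1 - norm \<zeta>) / (1 + norm \<zeta>) * Re (f 0) \<le> Re (f \<zeta>)"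
proof -
  define g where "g = (\<lambda>\<zeta>. (f \<zeta> - f 0) / (f \<zeta> + cnj (f 0)))"
  have re: "Re (f \<zeta> + cnj (f 0)) > 0" if "norm \<zeta> < 1" for \<zeta>
    using pos[OF that] pos[of 0] by simp
  have nz: "f \<zeta> + cnj (f 0) \<noteq> 0" if "norm \<zeta> < 1" for \<zeta>
    using re[OF that] by (metis less_irrefl zero_complex.sel(1))
  have "norm (g \<zeta>) \<le> norm \<zeta>"
  proof (rule Schwarz_Lemma(1))
    show "g holomorphic_on ball 0 1"
      unfolding g_def using nz by (intro holomorphic_intros holf) auto
    show "g 0 = 0" by (simp add: g_def)
    fix \<xi> :: complex assume \<xi>: "norm \<xi> < 1"
    have "norm (f \<xi> - f 0) ^ 2 < norm (f \<xi> + cnj (f 0)) ^ 2"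
    proof -
      have "0 < Re (f \<xi>) * Re (f 0)" using pos[OF \<xi>] pos[of 0] by simp
      moreover have "norm (f \<xi> + cnj (f 0)) ^ 2 = norm (f \<xi> - f 0) ^ 2 + 4 * (Re (f \<xi>) * Re (f 0))"
        by (simp only: cmod_power2) (simp add: power2_eq_square algebra_simps)
      ultimately show ?thesis by simp
    qed
    then have "norm (f \<xi> - f 0) < norm (f \<xi> + cnj (f 0))"
      using power2_less_imp_less norm_ge_zero by blast
    then show "norm (g \<xi>) < 1"
      using nz[OF \<xi>] by (simp add: g_def norm_divide)
  qed (use \<zeta> in auto)
  then have "norm (f \<zeta> - f 0) \<le> norm \<zeta> * norm (f \<zeta> + cnj (f 0))"
    using nz[OF \<zeta>] by (simp add: g_def norm_divide field_simps)
  then have "norm (f \<zeta> - f 0) ^ 2 \<le> (norm \<zeta> * norm (f \<zeta> + cnj (f 0))) ^ 2"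
    by (intro power_mono) auto
  then have sq: "(Re (f \<zeta>) - Re (f 0))\<^sup>2 + (Im (f \<zeta>) - Im (f 0))\<^sup>2
      \<le> (norm \<zeta>)\<^sup>2 * (Re (f \<zeta>) + Re (f 0))\<^sup>2 + (norm \<zeta>)\<^sup>2 * (Im (f \<zeta>) - Im (f 0))\<^sup>2"
    by (simp add: cmod_power2 power_mult_distrib algebra_simps)
  have "(norm \<zeta>)\<^sup>2 * (Im (f \<zeta>) - Im (f 0))\<^sup>2 \<le> (Im (f \<zeta>) - Im (f 0))\<^sup>2"
    using \<zeta> by (intro mult_left_le_one_le) (auto simp: power_le_one)
  with sq have "(Re (f 0) - Re (f \<zeta>))\<^sup>2 \<le> (norm \<zeta> * (Re (f \<zeta>) + Re (f 0)))\<^sup>2"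
    unfolding power_mult_distrib power2_commute[of "Re (f 0)" "Re (f \<zeta>)"] by linarith
  then have "Re (f 0) - Re (f \<zeta>) \<le> norm \<zeta> * (Re (f \<zeta>) + Re (f 0))"
  proof (rule power2_le_imp_le)
    show "0 \<le> norm \<zeta> * (Re (f \<zeta>) + Re (f 0))"
      using pos[OF \<zeta>] pos[of 0] by simp
  qed
  then have "(1 - norm \<zeta>) * Re (f 0) \<le> Re (f \<zeta>) * (1 + norm \<zeta>)"
    unfolding left_diff_distrib distrib_left by (simp add: mult.commute)
  moreover have "1 + norm \<zeta> > 0"
    by (simp add: add_pos_nonneg)
  ultimately show ?thesis
    by (simp add: pos_divide_le_eq)
qed

lemma norm_vector_scalar_mult: "norm ((c::complex) *s v) = norm c * norm v"
  by (simp add: norm_vec_def norm_mult L2_set_right_distrib)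

lemma holomorphic_several_on_line:
  assumes F: "holomorphic_several F D" and D: "\<And>\<zeta>. \<zeta> \<in> S \<Longrightarrow> c + \<zeta> *s v \<in> D"
  shows "(\<lambda>\<zeta>. F (c + \<zeta> *s v)) holomorphic_on S"
proof (rule holomorphic_onI)
  fix \<zeta> assume "\<zeta> \<in> S"
  then obtain L where L: "(F has_derivative L) (at (c + \<zeta> *s v))" and lin: "Vector_Spaces.linear (*s) (*) L"
    using F D unfolding holomorphic_several_def by blast
  have "linear (\<lambda>\<zeta>::complex. \<zeta> *s v)"
    by (rule linearI) (simp_all add: vec_eq_iff algebra_simps scaleR_conv_of_real[where 'a=complex])
  then have der: "((\<lambda>\<zeta>. c + \<zeta> *s v) has_derivative (\<lambda>\<zeta>. \<zeta> *s v)) (at \<zeta>)"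
    by (auto intro!: derivative_eq_intros linear_imp_has_derivative)
  have "((\<lambda>\<zeta>. F (c + \<zeta> *s v)) has_derivative (\<lambda>\<zeta>. L (\<zeta> *s v))) (at \<zeta>)"
    using diff_chain_at[OF der L] by (simp add: o_def)
  moreover have "(\<lambda>\<zeta>. L (\<zeta> *s v)) = (*) (L v)"
    using lin by (simp add: fun_eq_iff Vector_Spaces.linear_iff mult.commute)
  ultimately have "((\<lambda>\<zeta>. F (c + \<zeta> *s v)) has_field_derivative L v) (at \<zeta>)"
    by (simp add: has_field_derivative_def)
  then show "(\<lambda>\<zeta>. F (c + \<zeta> *s v)) field_differentiable at \<zeta> within S"
    by (metis field_differentiable_def has_field_derivative_at_within)
qed

definition halfplane_holomorphic :: "(complex^'n \<Rightarrow> complex) \<Rightarrow> (complex^'n) set \<Rightarrow> bool" where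
  "halfplane_holomorphic F D \<longleftrightarrow> holomorphic_several F D \<and> (\<forall>z\<in>D. Re (F z) > 0)"

text \<open>
  The complex line through \<open>c\<close> and \<open>z\<close> meets the ball in a disc of radius \<open>R\<close> centred at \<open>c\<close>, so the
  inequality in one variable applies to the restriction of \<open>F\<close> to this disc.
\<close>

lemma harnack_ball:
  assumes F: "halfplane_holomorphic F D" and D: "ball c R \<subseteq> D" and z: "z \<in> ball c R"
  shows "(R - dist c z) / (R + dist c z) * Re (F c) \<le> Re (F z)"
proof (cases "z = c")
  case True
  then show ?thesis using z by simp
next
  case False
  then have d: "dist c z > 0" and dR: "dist c z < R"
    using z by auto
  define v where "v = (R / dist c z) *\<^sub>R (z - c)"
  have "norm v = \<bar>R\<bar>"
    using False by (simp add: v_def dist_norm norm_minus_commute)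
  then have nv: "norm v = R"
    using abs_of_pos[OF order.strict_trans[OF d dR]] by (rule trans)
  have in_ball: "c + \<zeta> *s v \<in> ball c R" if "norm \<zeta> < 1" for \<zeta>
    using that order.strict_trans[OF d dR] by (simp add: dist_norm norm_vector_scalar_mult nv)
  have Rpos: "R > 0" by (rule order.strict_trans[OF d dR])
  define \<zeta> :: complex where "\<zeta> = of_real (dist c z / R)"
  have n\<zeta>: "norm \<zeta> = dist c z / R"
    by (simp add: \<zeta>_def norm_divide abs_of_pos[OF Rpos])
  have "(1 - norm \<zeta>) / (1 + norm \<zeta>) * Re (F (c + 0 *s v)) \<le> Re (F (c + \<zeta> *s v))"
  proof (rule harnack_unit_disc)
    show "(\<lambda>\<zeta>. F (c + \<zeta> *s v)) holomorphic_on ball 0 1"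
      using F D in_ball unfolding halfplane_holomorphic_def
      by (intro holomorphic_several_on_line) auto
    show "norm \<zeta> < 1" unfolding n\<zeta> pos_divide_less_eq[OF Rpos] using dR by simp
    show "Re (F (c + \<xi> *s v)) > 0" if "norm \<xi> < 1" for \<xi>
      using F subsetD[OF D in_ball[OF that]] by (auto simp: halfplane_holomorphic_def)
  qed
  moreover have "c + \<zeta> *s v = z"
    using False Rpos[THEN less_imp_neq]
    by (simp add: \<zeta>_def v_def vec_eq_iff scaleR_conv_of_real[where 'a=complex])
  moreover have "(1 - norm \<zeta>) / (1 + norm \<zeta>) = (R - dist c z) / (R + dist c z)"
  proof -
    have "(1 - dist c z / R) / (1 + dist c z / R)
        = (R * (1 - dist c z / R)) / (R * (1 + dist c z / R))"
      using Rpos[THEN less_imp_neq] by (intro mult_divide_mult_cancel_left[symmetric]) auto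
    then show ?thesis
      using Rpos[THEN less_imp_neq] by (simp add: n\<zeta> right_diff_distrib distrib_left)
  qed
  ultimately show ?thesis by simp
qed

lemma harnack_half_ball:
  assumes F: "halfplane_holomorphic F D" and D: "ball c R \<subseteq> D" and z: "dist c z \<le> R / 2" and R: "R > 0"
  shows "Re (F c) / 3 \<le> Re (F z)"
proof -
  have "(R - dist c z) / (R + dist c z) * Re (F c) \<le> Re (F z)"
    using z R by (intro harnack_ball[OF F D]) auto
  moreover have "Re (F c) > 0"
    using F D R unfolding halfplane_holomorphic_def by (meson centre_in_ball subsetD)
  moreover have "R + dist c z > 0"
    using R by (simp add: add_pos_nonneg)
  then have "1/3 \<le> (R - dist c z) / (R + dist c z)"
    using z by (simp add: field_simps)
  ultimately show ?thesis
    using mult_right_mono[of "1/3" "(R - dist c z) / (R + dist c z)" "Re (F c)"] by linarith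
qed

section \<open>Harnack chains in a bounded convex domain\<close>

text \<open>
  The homothety with centre \<open>z\<close> and ratio \<open>t\<close> maps the convex set into itself, and it shrinks the
  ball around \<open>a\<close> to a ball of radius \<open>t * R\<close>.
\<close>

lemma ball_towards_point:
  fixes a z :: "'a::real_normed_vector"
  assumes D: "convex D" "ball a R \<subseteq> D" "z \<in> D" and t: "0 < t" "t \<le> 1"
  shows "ball (z + t *\<^sub>R (a - z)) (t * R) \<subseteq> D"
proof
  fix y assume y: "y \<in> ball (z + t *\<^sub>R (a - z)) (t * R)"
  define y' where "y' = a + (1/t) *\<^sub>R (y - (z + t *\<^sub>R (a - z)))"
  have "dist a y' < R"
  proof -
    have "dist a y' = (1/t) * dist (z + t *\<^sub>R (a - z)) y"
      using t by (simp add: y'_def dist_norm norm_minus_commute)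
    with y t show ?thesis
      by (simp only: mem_ball) (simp add: field_simps del: scaleR_right_diff_distrib)
  qed
  then have "y' \<in> D" using D(2) by auto
  then have "(1 - t) *\<^sub>R z + t *\<^sub>R y' \<in> D"
    using D t by (intro convexD) auto
  moreover have "(1 - t) *\<^sub>R z + t *\<^sub>R y' = y"
    using t by (simp add: y'_def algebra_simps)
  ultimately show "y \<in> D" by simp
qed

text \<open>
  The points \<open>z + q^k (a - z)\<close> approach \<open>z\<close> geometrically, and around the \<open>k\<close>-th of them the domain
  contains a ball of radius \<open>q^k * R\<close>. The ratio \<open>q = 1 - R / (2 M)\<close> is chosen so that each
  point lies within half the radius of the ball around the preceding one; then each step costs the
  factor 3.
\<close>

lemma harnack_chain:
  assumes F: "halfplane_holomorphic F D" and D: "convex D" "ball a R \<subseteq> D" "z \<in> D"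
    and R: "0 < R" "R \<le> M" and M: "dist a z \<le> M"
  shows "Re (F a) / 3 ^ k \<le> Re (F (z + (1 - R / (2 * M)) ^ k *\<^sub>R (a - z)))"
proof (induction k)
  case 0
  then show ?case by simp
next
  case (Suc k)
  define q where "q = 1 - R / (2 * M)"
  have q: "0 < q" "q < 1" using R by (auto simp: q_def field_simps)
  have qk: "0 < q ^ k" "q ^ k \<le> 1" using q by (auto intro: power_le_one)
  let ?p = "z + q ^ k *\<^sub>R (a - z)" and ?p' = "z + q ^ Suc k *\<^sub>R (a - z)"
  have "?p - ?p' = (q ^ k * (1 - q)) *\<^sub>R (a - z)"
    by (simp add: algebra_simps)
  then have "dist ?p ?p' = q ^ k * (1 - q) * dist a z"
    using q by (simp add: dist_norm)
  also have "\<dots> \<le> q ^ k * (1 - q) * M"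
    using q M by (intro mult_left_mono) auto
  also have "\<dots> = q ^ k * R / 2"
    using R by (simp add: q_def)
  finally have "Re (F ?p) / 3 \<le> Re (F ?p')"
    using ball_towards_point[OF D qk] qk R by (intro harnack_half_ball[OF F, where R = "q ^ k * R"]) auto
  with Suc show ?case by (simp add: q_def)
qed

text \<open>
  With \<open>q = 1 - R / (2 M)\<close>, the chain comes within distance \<open>r / 3\<close> of \<open>z\<close> as soon as
  \<open>q^k * M \<le> r / 3\<close>, that is, after about \<open>ln (3 M / r) / ln (1 / q)\<close> steps. Since
  \<open>3^(ln x / ln (1 / q)) = x powr (ln 3 / ln (1 / q))\<close>, the accumulated factor is a power of
  \<open>r\<close> with exponent \<open>ln 3 / ln (1 / q)\<close>, which is at least 1 because \<open>q \<ge> 1/2\<close>.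
\<close>

lemma harnack_convex:
  fixes D :: "(complex^'n) set"
  assumes D: "convex D" "bounded D" "open D" "a \<in> D"
  obtains \<alpha> C where "\<alpha> \<ge> 1" "C > 0"
    "\<And>F z r. halfplane_holomorphic F D \<Longrightarrow> 0 < r \<Longrightarrow> ball z r \<subseteq> D \<Longrightarrow> C * r powr \<alpha> * Re (F a) \<le> Re (F z)"
proof -
  obtain R where R: "R > 0" "ball a R \<subseteq> D"
    using D open_contains_ball by blast
  obtain M where M: "R \<le> M" "D \<subseteq> cball a M"
  proof -
    obtain M where "D \<subseteq> cball a M"
      using D(2) unfolding bounded_any_center[where a=a] mem_cball subset_iff by blast
    then have "D \<subseteq> cball a (max R M)" by auto
    then show ?thesis using that[of "max R M"] by simp
  qed
  define q where "q = 1 - R / (2 * M)"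
  have q: "1/2 \<le> q" "q < 1" using R M by (auto simp: q_def field_simps)
  define \<alpha> where "\<alpha> = ln 3 / ln (1 / q)"
  have lnq: "0 < ln (1 / q)" "ln (1 / q) \<le> ln 3"
    using q by (auto intro!: ln_mono simp: field_simps)
  have \<alpha>: "\<alpha> \<ge> 1" using lnq by (simp add: \<alpha>_def)
  define C where "C = 1 / 9 * (1 / (3 * M)) powr \<alpha>"
  have C: "C > 0" using R M by (simp add: C_def)
  have "C * r powr \<alpha> * Re (F a) \<le> Re (F z)"
    if F: "halfplane_holomorphic F D" and r: "0 < r" "ball z r \<subseteq> D" for F z r
  proof -
    have zD: "z \<in> D" using r by auto
    have "ball z r \<subseteq> cball a M" using r M by auto
    then have rM: "r \<le> M" and zM: "dist a z \<le> M"
      using r(1) unfolding ball_subset_cball_iff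
      by (auto simp: dist_commute intro: order_trans[of _ "dist a z + r"])
    have Mpos: "M > 0" using R M by simp
    define x where "x = ln (3 * M / r) / ln (1 / q)"
    have x0: "x \<ge> 0" using rM r Mpos lnq by (simp add: x_def)
    define k where "k = nat \<lceil>x\<rceil>"
    have k: "x \<le> real k" "real k \<le> x + 1" using x0 by (auto simp: k_def)
    have "ln (3 * M / r) \<le> real k * ln (1 / q)"
      using k lnq by (simp add: x_def divide_le_eq)
    also have "\<dots> = ln ((1 / q) ^ k)" using q by (simp add: ln_realpow)
    finally have "3 * M / r \<le> (1 / q) ^ k"
    proof (rule ln_le_cancel_iff[THEN iffD1, rotated 2])
      show "3 * M / r > 0" "(1 / q) ^ k > 0" using Mpos r q by simp_all
    qed
    then have qkM: "q ^ k * M \<le> r / 3"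
    proof -
      assume "3 * M / r \<le> (1 / q) ^ k"
      then have "q ^ k * (3 * M / r) \<le> q ^ k * (1 / q) ^ k"
        using q by (intro mult_left_mono) auto
      also have "\<dots> = 1" using q by (simp add: power_divide)
      finally show ?thesis using r by (simp add: field_simps)
    qed
    have "dist z (z + q ^ k *\<^sub>R (a - z)) = q ^ k * dist a z"
      using q by (simp add: dist_norm norm_minus_commute)
    also have "\<dots> \<le> q ^ k * M" using q zM by (intro mult_left_mono) auto
    finally have near: "dist z (z + q ^ k *\<^sub>R (a - z)) \<le> r / 3" using qkM by simp
    have pos: "Re (F a) > 0" using F D(4) by (auto simp: halfplane_holomorphic_def)
    have "Re (F a) / 3 ^ k / 3 \<le> Re (F (z + q ^ k *\<^sub>R (a - z))) / 3"
      using harnack_chain[OF F D(1) R(2) zD R(1) M(1) zM, of k] by (simp add: q_def)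
    also have "\<dots> \<le> Re (F z)"
    \<comment> \<open>The last point of the chain lies within \<open>r / 3\<close> of \<open>z\<close>, so it is itself
        the centre of a ball of radius \<open>2 r / 3\<close> in the domain.\<close>
    proof (rule harnack_half_ball[OF F, where R = "2 * r / 3"])
      show "ball (z + q ^ k *\<^sub>R (a - z)) (2 * r / 3) \<subseteq> D"
      proof -
        have "ball (z + q ^ k *\<^sub>R (a - z)) (2 * r / 3) \<subseteq> ball z r"
          using near by (subst ball_subset_ball_iff) (simp add: dist_commute)
        with r(2) show ?thesis by blast
      qed
    qed (use r near in \<open>auto simp: dist_commute\<close>)
    finally have *: "Re (F a) / (3 * 3 ^ k) \<le> Re (F z)" by simp
    have "(3::real) ^ k = exp (real k * ln 3)" by (simp add: exp_of_nat_mult)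
    also have "\<dots> \<le> exp ((x + 1) * ln 3)" using k by simp
    also have "\<dots> = 3 * (3 * M / r) powr \<alpha>"
      using r Mpos by (simp add: powr_def x_def \<alpha>_def algebra_simps exp_add)
    finally have "3 * 3 ^ k \<le> 9 * (3 * M / r) powr \<alpha>" by simp
    then have "1 / (9 * (3 * M / r) powr \<alpha>) \<le> 1 / (3 * 3 ^ k)"
      by (intro divide_left_mono) (use r Mpos in auto)
    moreover have "1 / (9 * (3 * M / r) powr \<alpha>) = C * r powr \<alpha>"
      using r Mpos by (simp add: C_def powr_divide)
    ultimately have "C * r powr \<alpha> * Re (F a) \<le> 1 / (3 * 3 ^ k) * Re (F a)"
      using pos by (intro mult_right_mono) auto
    with * show ?thesis by simp
  qed
  with \<alpha> C show ?thesis using that by blast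
qed

section \<open>Interior balls of a domain with \<open>C\<^sup>2\<close> boundary\<close>

text \<open>
  Taylor's estimate by two applications of the mean value inequality, first to the derivative and
  then to \<open>\<rho>\<close> minus its linear part. The constant is \<open>K\<close> instead of the sharp \<open>K / 2\<close>.
\<close>

lemma second_order_upper_bound:
  fixes \<rho> :: "'a::real_normed_vector \<Rightarrow> real"
    and \<rho>' :: "'a \<Rightarrow> 'a \<Rightarrow>\<^sub>L real" and \<rho>'' :: "'a \<Rightarrow> 'a \<Rightarrow>\<^sub>L 'a \<Rightarrow>\<^sub>L real"
  assumes S: "convex S" "p \<in> S" "p + h \<in> S"
    and d1: "\<And>x. x \<in> S \<Longrightarrow> (\<rho> has_derivative \<rho>' x) (at x)"
    and d2: "\<And>x. x \<in> S \<Longrightarrow> (\<rho>' has_derivative \<rho>'' x) (at x)"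
    and K: "\<And>x. x \<in> S \<Longrightarrow> norm (\<rho>'' x) \<le> K"
  shows "\<rho> (p + h) \<le> \<rho> p + \<rho>' p h + K * (norm h)\<^sup>2"
proof -
  have K0: "K \<ge> 0" using K[OF S(2)] norm_ge_zero order_trans by blast
  have lip: "norm (\<rho>' x - \<rho>' p) \<le> K * norm (x - p)" if "x \<in> S" for x
    by (rule differentiable_bound[OF S(1) has_derivative_at_withinI[OF d2]])
       (use K that S in \<open>auto simp flip: norm_blinfun.rep_eq\<close>)
  define I where "I = closed_segment p (p + h)"
  have IS: "I \<subseteq> S" using S by (simp add: I_def closed_segment_subset)
  have Ih: "norm (x - p) \<le> norm h" if "x \<in> I" for x
    using that segment_bound1[of x p "p + h"] by (simp add: I_def)
  have "norm ((\<rho> (p + h) - \<rho>' p (p + h)) - (\<rho> p - \<rho>' p p)) \<le> K * norm h * norm ((p + h) - p)"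
  proof (rule differentiable_bound[of I _ "\<lambda>x. blinfun_apply (\<rho>' x - \<rho>' p)"])
    fix x assume x: "x \<in> I"
    show "((\<lambda>x. \<rho> x - \<rho>' p x) has_derivative (\<rho>' x - \<rho>' p)) (at x within I)"
      using x IS by (auto intro!: derivative_eq_intros has_derivative_at_withinI[OF d1] simp: blinfun.diff_left)
    have "norm (\<rho>' x - \<rho>' p) \<le> K * norm (x - p)" using x IS by (intro lip) auto
    also have "\<dots> \<le> K * norm h" using Ih[OF x] K0 by (intro mult_left_mono)
    finally show "onorm (\<rho>' x - \<rho>' p) \<le> K * norm h" by (simp add: norm_blinfun.rep_eq)
  qed (auto simp: I_def)
  then show ?thesis
    by (simp add: blinfun.add_right power2_eq_square abs_le_iff algebra_simps)
qed

text \<open>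
  By continuity the functional is nonpositive on the hyperplane orthogonal to \<open>\<nu>\<close> as well, and by
  symmetry it vanishes there. Applied to the differential of a defining function, this identifies
  \<open>\<nu>\<close> as its negative normalized gradient.
\<close>

lemma functional_nonpos_on_halfspace:
  fixes A :: "'a::real_inner \<Rightarrow>\<^sub>L real"
  assumes \<nu>: "norm \<nu> = 1" and neg: "\<And>h. inner h \<nu> > 0 \<Longrightarrow> A h \<le> 0"
  shows "A h = - norm A * inner h \<nu>"
proof -
  have nn: "inner \<nu> \<nu> = 1" using \<nu> by (simp add: norm_eq_1)
  have le: "A g \<le> 0" if g: "inner g \<nu> = 0" for g
  proof (rule ccontr)
    assume "\<not> A g \<le> 0"
    then have pos: "A g > 0" by simp
    define B where "B = \<bar>A \<nu>\<bar> + 1"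
    define t where "t = A g / (2 * B)"
    have B: "B > 0" by (simp add: B_def add_nonneg_pos)
    have t: "t > 0" using pos B by (simp add: t_def)
    have "A (g + t *\<^sub>R \<nu>) \<le> 0" using g t nn by (intro neg) (simp add: inner_add_left)
    moreover have "t * B = A g / 2" using B by (simp add: t_def)
    then have "t * \<bar>A \<nu>\<bar> < A g" using t pos by (simp add: distrib_left B_def)
    moreover have "- (t * \<bar>A \<nu>\<bar>) \<le> t * A \<nu>" using t
      by (metis abs_ge_minus_self abs_mult abs_of_pos minus_le_iff)
    ultimately show False by (simp add: blinfun.add_right blinfun.scaleR_right)
  qed
  have A0: "A g = 0" if "inner g \<nu> = 0" for g
    using le[OF that] le[of "- g"] that by (simp add: blinfun.minus_right)
  have form: "A h = A \<nu> * inner h \<nu>" for h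
  proof -
    have "A (h - inner h \<nu> *\<^sub>R \<nu>) = 0" using nn by (intro A0) (simp add: inner_diff_left)
    then show ?thesis by (simp add: blinfun.diff_right blinfun.scaleR_right)
  qed
  have A\<nu>: "A \<nu> \<le> 0" using neg[of \<nu>] nn by simp
  have "norm A = - A \<nu>"
  proof (rule antisym)
    show "norm A \<le> - A \<nu>"
    proof (rule norm_blinfun_bound)
      fix x
      have "norm (A x) = - A \<nu> * \<bar>inner x \<nu>\<bar>" using form[of x] A\<nu> by (simp add: abs_mult)
      also have "\<dots> \<le> - A \<nu> * norm x"
        using A\<nu> Cauchy_Schwarz_ineq2[of x \<nu>] \<nu> by (intro mult_left_mono) auto
      finally show "norm (A x) \<le> - A \<nu> * norm x" .
    qed (use A\<nu> in simp)
    show "- A \<nu> \<le> norm A" using norm_blinfun[of A \<nu>] \<nu> by simp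
  qed
  then show ?thesis using form[of h] by simp
qed

text \<open>
  If some ball inside \<open>D\<close> touches the boundary at \<open>p\<close>, then the derivative of the defining function
  \<open>\<rho>\<close> at \<open>p\<close> is nonpositive in all directions pointing into that ball, so that the direction \<open>\<nu>\<close> to
  its centre is the inner normal. For a point \<open>p + h\<close> of a ball of radius \<open>e\<close> touching at \<open>p\<close> with the
  same normal, \<open>|h|\<^sup>2 < 2 e \<langle>h, \<nu>\<rangle>\<close>; so for small \<open>e\<close> the linear term of \<open>\<rho>\<close> dominates the quadratic
  error and \<open>\<rho> (p + h) < 0\<close>. The bounds on the derivatives are uniform near \<open>p0\<close>, hence so
  is the radius.
\<close>

lemma C2_boundary_local_interior_ball:
  fixes D :: "'a::real_inner set"
  assumes D: "open D" "C2_boundary D" "p0 \<in> frontier D"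
  obtains \<epsilon> where "\<epsilon> > 0"
    "\<And>p \<nu> s e. p \<in> frontier D \<Longrightarrow> dist p0 p < \<epsilon> \<Longrightarrow> norm \<nu> = 1 \<Longrightarrow> s > 0 \<Longrightarrow>
        ball (p + s *\<^sub>R \<nu>) s \<subseteq> D \<Longrightarrow> 0 < e \<Longrightarrow> e \<le> \<epsilon> \<Longrightarrow> ball (p + e *\<^sub>R \<nu>) e \<subseteq> D"
proof -
  obtain U \<rho> and \<rho>' :: "'a \<Rightarrow> 'a \<Rightarrow>\<^sub>L real" and \<rho>'' :: "'a \<Rightarrow> 'a \<Rightarrow>\<^sub>L 'a \<Rightarrow>\<^sub>L real"
    where U: "open U" "p0 \<in> U"
    and d1': "\<forall>x\<in>U. (\<rho> has_derivative \<rho>' x) (at x)"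
    and d2': "\<forall>x\<in>U. (\<rho>' has_derivative \<rho>'' x) (at x)"
    and c2: "continuous_on U \<rho>''" and nz: "\<forall>x\<in>U. \<rho>' x \<noteq> 0"
    and DU: "D \<inter> U = {x\<in>U. \<rho> x < 0}"
    using bspec[OF D(2)[unfolded C2_boundary_def] D(3)] by (elim exE conjE) (rule that)
  note d1 = bspec[OF d1'] and d2 = bspec[OF d2']
  define K where "K = norm (\<rho>'' p0) + 1"
  define \<kappa> where "\<kappa> = norm (\<rho>' p0) / 2"
  have K: "K > 0" by (simp add: K_def add_nonneg_pos)
  have \<kappa>: "\<kappa> > 0" using bspec[OF nz U(2)] by (simp add: \<kappa>_def)
  have "((\<lambda>x. norm (\<rho>'' x)) \<longlongrightarrow> norm (\<rho>'' p0)) (nhds p0)"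
    using c2 U by (intro tendsto_norm) (simp add: continuous_on_eq_continuous_at isCont_def tendsto_at_iff_tendsto_nhds)
  then have "\<forall>\<^sub>F x in nhds p0. norm (\<rho>'' x) < K"
    by (rule order_tendstoD) (simp add: K_def)
  moreover have "((\<lambda>x. norm (\<rho>' x)) \<longlongrightarrow> norm (\<rho>' p0)) (nhds p0)"
    using has_derivative_continuous[OF d2[OF U(2)]]
    by (intro tendsto_norm) (simp add: isCont_def tendsto_at_iff_tendsto_nhds)
  then have "\<forall>\<^sub>F x in nhds p0. \<kappa> < norm (\<rho>' x)"
    by (rule order_tendstoD) (use \<kappa> in \<open>simp add: \<kappa>_def\<close>)
  moreover have "\<forall>\<^sub>F x in nhds p0. x \<in> U"
    using U by (rule eventually_nhds_in_open)
  ultimately have "\<forall>\<^sub>F x in nhds p0. norm (\<rho>'' x) < K \<and> \<kappa> < norm (\<rho>' x) \<and> x \<in> U"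
    by eventually_elim auto
  then obtain \<eta> where \<eta>: "\<eta> > 0"
    "\<And>x. x \<in> ball p0 \<eta> \<Longrightarrow> norm (\<rho>'' x) < K \<and> \<kappa> < norm (\<rho>' x) \<and> x \<in> U"
    unfolding eventually_nhds_metric by (auto simp: dist_commute)
  \<comment> \<open>\<open>\<eta> / 3\<close> keeps the touching ball inside \<open>ball p0 \<eta>\<close>; \<open>\<kappa> / (2 K)\<close> makes the linear term win against \<open>K |h|\<^sup>2\<close>.\<close>
  define \<epsilon> where "\<epsilon> = min (\<eta> / 3) (\<kappa> / (2 * K))"
  show thesis
  proof (rule that)
    show "\<epsilon> > 0" using \<eta> K \<kappa> by (simp add: \<epsilon>_def)
    fix p \<nu> s e
    assume p: "p \<in> frontier D" "dist p0 p < \<epsilon>" and \<nu>: "norm \<nu> = 1"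
      and s: "s > 0" "ball (p + s *\<^sub>R \<nu>) s \<subseteq> D" and e: "0 < e" "e \<le> \<epsilon>"
    have p\<eta>: "p \<in> ball p0 \<eta>" using p \<eta> by (simp add: \<epsilon>_def)
    then have pU: "p \<in> U" using \<eta> by blast
    have nn: "inner \<nu> \<nu> = 1" using \<nu> by (simp add: norm_eq_1)
    have in_ball: "norm (h - t *\<^sub>R \<nu>) < t \<longleftrightarrow> (norm h)\<^sup>2 < 2 * t * inner h \<nu>" if "t > 0" for h t
    proof -
      have "norm (h - t *\<^sub>R \<nu>) < t \<longleftrightarrow> (norm (h - t *\<^sub>R \<nu>))\<^sup>2 < t\<^sup>2"
        using that power_strict_mono[of "norm (h - t *\<^sub>R \<nu>)" t 2]
          power2_less_imp_less[of "norm (h - t *\<^sub>R \<nu>)" t] by auto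
      also have "(norm (h - t *\<^sub>R \<nu>))\<^sup>2 = (norm h)\<^sup>2 - 2 * t * inner h \<nu> + t\<^sup>2"
        unfolding power2_norm_eq_inner using nn
        by (simp add: inner_diff_left inner_diff_right inner_commute power2_eq_square)
      finally show ?thesis by simp
    qed
    have "p \<notin> D" using p D(1) by (simp add: frontier_def interior_open)
    then have \<rho>0: "\<rho> p \<ge> 0" using DU pU by force
    have \<rho>p: "\<rho> p \<le> 0"
    proof (rule ccontr)
      assume "\<not> \<rho> p \<le> 0"
      then have "\<forall>\<^sub>F x in nhds p. \<rho> x > 0"
        using has_derivative_continuous[OF d1[OF pU]]
        by (intro order_tendstoD(1)[of \<rho>]) (auto simp: isCont_def tendsto_at_iff_tendsto_nhds)
      then have "\<forall>\<^sub>F x in nhds p. x \<notin> D"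
        using eventually_nhds_in_open[OF U(1) pU] by eventually_elim (use DU in force)
      then obtain V where "open V" "p \<in> V" "V \<inter> D = {}"
        unfolding eventually_nhds by blast
      then have "p \<notin> closure D" by (metis disjoint_iff open_Int_closure_eq_empty)
      then show False using p by (simp add: frontier_def)
    qed
    \<comment> \<open>Small multiples of \<open>h\<close> lead from \<open>p\<close> into the touching ball, where \<open>\<rho>\<close> is negative.\<close>
    have "\<rho>' p h \<le> 0" if h: "inner h \<nu> > 0" for h
    proof (rule ccontr)
      assume "\<not> \<rho>' p h \<le> 0"
      have "((\<lambda>t. \<rho> (p + t *\<^sub>R h)) has_derivative (\<lambda>t. \<rho>' p (t *\<^sub>R h))) (at 0)"
      proof -
        have "((\<lambda>t. p + t *\<^sub>R h) has_derivative (\<lambda>t. t *\<^sub>R h)) (at 0)"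
          by (auto intro!: derivative_eq_intros)
        from diff_chain_at[OF this, of \<rho> "\<rho>' p"] d1[OF pU] show ?thesis by (simp add: o_def)
      qed
      then have "((\<lambda>t. \<rho> (p + t *\<^sub>R h)) has_real_derivative \<rho>' p h) (at 0)"
        by (simp add: has_field_derivative_def blinfun.scaleR_right mult_commute_abs)
      from DERIV_pos_inc_right[OF this] \<open>\<not> \<rho>' p h \<le> 0\<close>
      obtain d where d: "d > 0" "\<And>t. 0 < t \<Longrightarrow> t < d \<Longrightarrow> \<rho> p < \<rho> (p + t *\<^sub>R h)"
        by auto
      have "\<forall>\<^sub>F t in at_right 0. p + t *\<^sub>R h \<in> U"
      proof -
        have "((\<lambda>t. p + t *\<^sub>R h) \<longlongrightarrow> p + 0 *\<^sub>R h) (at_right 0)"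
          by (intro tendsto_intros)
        then show ?thesis using U(1) pU by (auto dest: topological_tendstoD)
      qed
      moreover have "\<forall>\<^sub>F t in at_right 0. t < d"
        using d(1) unfolding eventually_at_right_field by blast
      moreover have "\<forall>\<^sub>F t in at_right 0. t * (norm h)\<^sup>2 < 2 * s * inner h \<nu>"
      proof (rule order_tendstoD(2))
        show "((\<lambda>t. t * (norm h)\<^sup>2) \<longlongrightarrow> 0 * (norm h)\<^sup>2) (at_right 0)"
          by (intro tendsto_intros)
      qed (use h s in simp)
      moreover have "\<forall>\<^sub>F t in at_right (0::real). t > 0"
        by (simp add: eventually_at_right_less)
      ultimately have "\<forall>\<^sub>F t in at_right (0::real). False"
      proof eventually_elim
        case (elim t)
        have "(norm (t *\<^sub>R h))\<^sup>2 = t * (t * (norm h)\<^sup>2)"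
          by (simp add: power2_eq_square)
        also have "\<dots> < t * (2 * s * inner h \<nu>)"
          using elim by (intro mult_strict_left_mono)
        finally have "norm (t *\<^sub>R h - s *\<^sub>R \<nu>) < s"
          using s by (subst in_ball) (simp_all add: mult_ac)
        then have "p + t *\<^sub>R h \<in> ball (p + s *\<^sub>R \<nu>) s"
          by (simp add: dist_norm norm_minus_commute)
        then have "\<rho> (p + t *\<^sub>R h) < 0" using s DU elim by blast
        with d(2)[of t] elim \<rho>0 show False by simp
      qed
      then show False by simp
    qed
    then have form: "\<rho>' p h = - norm (\<rho>' p) * inner h \<nu>" for h
      using functional_nonpos_on_halfspace[OF \<nu>, of "\<rho>' p"] by blast
    show "ball (p + e *\<^sub>R \<nu>) e \<subseteq> D"
    proof
      fix x assume x: "x \<in> ball (p + e *\<^sub>R \<nu>) e"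
      define h where "h = x - p"
      have "norm (h - e *\<^sub>R \<nu>) < e"
        using x by (simp add: h_def dist_norm norm_minus_commute algebra_simps)
      then have h: "(norm h)\<^sup>2 < 2 * e * inner h \<nu>" using in_ball e by blast
      have hpos: "inner h \<nu> > 0"
        using h e by (smt (verit) zero_le_power2 mult_nonneg_nonpos)
      have "dist p x < 2 * e"
        using x e \<nu> dist_triangle[of p x "p + e *\<^sub>R \<nu>"] by (simp add: dist_norm)
      then have x\<eta>: "x \<in> ball p0 \<eta>"
        using p e dist_triangle[of p0 x p] by (simp add: \<epsilon>_def)
      have "\<rho> (p + h) \<le> \<rho> p + \<rho>' p h + K * (norm h)\<^sup>2"
        using p\<eta> x\<eta> \<eta>(2) by (intro second_order_upper_bound[OF convex_ball[of p0 \<eta>] _ _ d1 d2])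
          (auto simp: h_def intro: less_imp_le)
      also have "\<dots> \<le> - \<kappa> * inner h \<nu> + K * (norm h)\<^sup>2"
      proof -
        have "\<kappa> * inner h \<nu> \<le> norm (\<rho>' p) * inner h \<nu>"
          using \<eta>(2)[OF p\<eta>] hpos by (intro mult_right_mono) auto
        with \<rho>p show ?thesis by (simp add: form)
      qed
      also have "\<dots> < - \<kappa> * inner h \<nu> + K * (2 * e * inner h \<nu>)"
        using h K by simp
      also have "\<dots> = (2 * K * e - \<kappa>) * inner h \<nu>" by (simp add: algebra_simps)
      also have "\<dots> \<le> 0"
      proof -
        have "e \<le> \<kappa> / (2 * K)" using e by (simp add: \<epsilon>_def)
        then have "2 * K * e \<le> \<kappa>" using K by (simp add: field_simps)
        then show ?thesis using hpos by (simp add: mult_nonpos_nonneg)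
      qed
      finally have "\<rho> x < 0" by (simp add: h_def)
      then show "x \<in> D" using DU \<eta>(2)[OF x\<eta>] by blast
    qed
  qed
qed

text \<open>
  The frontier is compact, so finitely many of the local radii suffice.
\<close>

lemma C2_boundary_interior_ball:
  fixes D :: "'a::euclidean_space set"
  assumes D: "open D" "bounded D" "C2_boundary D"
  obtains \<epsilon> where "\<epsilon> > 0"
    "\<And>p \<nu> s. p \<in> frontier D \<Longrightarrow> norm \<nu> = 1 \<Longrightarrow> s > 0 \<Longrightarrow>
        ball (p + s *\<^sub>R \<nu>) s \<subseteq> D \<Longrightarrow> ball (p + \<epsilon> *\<^sub>R \<nu>) \<epsilon> \<subseteq> D"
proof -
  have "\<forall>p0\<in>frontier D. \<exists>\<epsilon>>0. \<forall>p \<nu> s e. p \<in> frontier D \<longrightarrow> dist p0 p < \<epsilon> \<longrightarrow> norm \<nu> = 1 \<longrightarrow> s > 0 \<longrightarrow>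
        ball (p + s *\<^sub>R \<nu>) s \<subseteq> D \<longrightarrow> 0 < e \<longrightarrow> e \<le> \<epsilon> \<longrightarrow> ball (p + e *\<^sub>R \<nu>) e \<subseteq> D"
    using C2_boundary_local_interior_ball[OF D(1,3)] by metis
  then obtain f where f: "\<And>p0. p0 \<in> frontier D \<Longrightarrow> f p0 > 0"
    "\<And>p0 p \<nu> s e. p0 \<in> frontier D \<Longrightarrow> p \<in> frontier D \<Longrightarrow> dist p0 p < f p0 \<Longrightarrow> norm \<nu> = 1 \<Longrightarrow> s > 0 \<Longrightarrow>
        ball (p + s *\<^sub>R \<nu>) s \<subseteq> D \<Longrightarrow> 0 < e \<Longrightarrow> e \<le> f p0 \<Longrightarrow> ball (p + e *\<^sub>R \<nu>) e \<subseteq> D"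
    by metis
  have "compact (frontier D)" using D(2) by (rule compact_frontier_bounded)
  then obtain T where T: "T \<subseteq> frontier D" "finite T" "frontier D \<subseteq> (\<Union>p\<in>T. ball p (f p))"
    by (rule compactE_image[of _ "frontier D" "\<lambda>p. ball p (f p)"]) (use f(1) in auto)
  define \<epsilon> where "\<epsilon> = Min (insert 1 (f ` T))"
  show thesis
  proof (rule that)
    show \<epsilon>: "\<epsilon> > 0" using T f(1) by (auto simp: \<epsilon>_def)
    fix p \<nu> s
    assume p: "p \<in> frontier D" and *: "norm \<nu> = 1" "s > 0" "ball (p + s *\<^sub>R \<nu>) s \<subseteq> D"
    obtain p0 where p0: "p0 \<in> T" "dist p0 p < f p0" using T(3) p by auto
    moreover have "\<epsilon> \<le> f p0" using p0 T(2) by (simp add: \<epsilon>_def)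
    ultimately show "ball (p + \<epsilon> *\<^sub>R \<nu>) \<epsilon> \<subseteq> D"
      using f(2) T(1) p * \<epsilon> by blast
  qed
qed

section \<open>Separation of points and convex sets\<close>

definition cinner :: "nat \<Rightarrow> (nat \<Rightarrow> complex) \<Rightarrow> (nat \<Rightarrow> complex) \<Rightarrow> complex" where
  "cinner m x u = (\<Sum>i<m. x i * cnj (u i))"

lemma cdist_nonneg [simp]: "0 \<le> cdist m x y"
  by (simp add: cdist_def)

lemma cdist_scale: "cdist m (\<lambda>i. of_real t * x i) (\<lambda>i. 0) = \<bar>t\<bar> * cdist m x (\<lambda>i. 0)"
  by (simp add: cdist_def norm_mult L2_set_right_distrib)

lemma Re_cinner_self: "Re (cinner m u u) = (cdist m u (\<lambda>i. 0))\<^sup>2"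
proof -
  have "Re (cinner m u u) = (\<Sum>i<m. (norm (u i))\<^sup>2)"
    unfolding cinner_def Re_sum by (simp only: cmod_power2) (simp add: power2_eq_square)
  then show ?thesis by (simp add: cdist_def L2_set_def sum_nonneg)
qed

lemma Re_cinner_le: "Re (cinner m x u) \<le> cdist m x (\<lambda>i. 0) * cdist m u (\<lambda>i. 0)"
proof -
  have "Re (cinner m x u) \<le> norm (cinner m x u)" by (rule complex_Re_le_cmod)
  also have "\<dots> \<le> (\<Sum>i<m. norm (x i) * norm (u i))"
    unfolding cinner_def by (rule order_trans[OF norm_sum]) (simp add: norm_mult)
  also have "\<dots> \<le> cdist m x (\<lambda>i. 0) * cdist m u (\<lambda>i. 0)"
    unfolding cdist_def using L2_set_mult_ineq[of "\<lambda>i. norm (x i)" "\<lambda>i. norm (u i)" "{..<m}"] by simp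
  finally show ?thesis .
qed

text \<open>
  For a nearest point, the left-hand side is minimal at \<open>t = 0\<close>; dividing by \<open>t\<close> and letting it tend
  to 0 turns this into the first-order condition on the inner product.
\<close>

lemma cdist_diff_line:
  "(cdist m a (\<lambda>i. of_real t * x i))\<^sup>2
    = (cdist m a (\<lambda>i. 0))\<^sup>2 - 2 * t * Re (cinner m x a) + t\<^sup>2 * (cdist m x (\<lambda>i. 0))\<^sup>2"
  unfolding cinner_def cdist_def L2_set_def
  by (simp add: sum_nonneg cmod_power2 sum_distrib_left flip: sum.distrib sum_subtractf)
     (simp add: power2_eq_square algebra_simps)

text \<open>
  Bounded sequences in \<open>Cspace m\<close> lie in a product of compact discs, which is compact in the product
  topology, and convergence there is coordinatewise.
\<close>

lemma bounded_cdist_convergent_subseq: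
  fixes y :: "nat \<Rightarrow> nat \<Rightarrow> complex"
  assumes y: "\<And>k. y k \<in> Cspace m" and M: "\<And>k. cdist m w (y k) \<le> M"
  obtains q \<sigma> where "q \<in> Cspace m" "strict_mono \<sigma>" "\<And>i. (\<lambda>k. y (\<sigma> k) i) \<longlonglongrightarrow> q i"
proof -
  define B where "B = PiE UNIV (\<lambda>i. if i < m then cball (w i) M else {0::complex})"
  have "compactin (product_topology (\<lambda>i. euclidean) UNIV) B"
    unfolding B_def by (subst compactin_PiE) auto
  then have "seq_compact B"
    by (simp add: euclidean_product_topology compact_imp_seq_compact)
  moreover have "y k \<in> B" for k
  proof -
    have "norm (w i - y k i) \<le> M" if "i < m" for i
      using member_le_L2_set[of "{..<m}" i "\<lambda>i. norm (w i - y k i)"] that M[of k]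
      by (simp add: cdist_def)
    then show ?thesis using y[of k] by (auto simp: B_def Cspace_def dist_norm)
  qed
  ultimately obtain q \<sigma> where q: "q \<in> B" "strict_mono \<sigma>" "(y \<circ> \<sigma>) \<longlonglongrightarrow> q"
    unfolding seq_compact_def by metis
  show thesis
  proof (rule that[of q \<sigma>])
    have "q i = 0" if "i \<ge> m" for i
      using PiE_mem[OF q(1)[unfolded B_def], of i] that by simp
    then show "q \<in> Cspace m" by (simp add: Cspace_def)
    show "(\<lambda>k. y (\<sigma> k) i) \<longlonglongrightarrow> q i" for i
    proof -
      have "isCont (\<lambda>x::nat \<Rightarrow> complex. x i) q"
        by (rule continuous_on_eq_continuous_at[THEN iffD1, rule_format, OF open_UNIV
              continuous_on_product_coordinates UNIV_I])
      from isCont_tendsto_compose[OF this q(3)] show ?thesis by (simp add: o_def)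
    qed
  qed (rule q(2))
qed

lemma tendsto_cdist:
  assumes "\<And>i. (\<lambda>k. x k i) \<longlonglongrightarrow> a i" "\<And>i. (\<lambda>k. y k i) \<longlonglongrightarrow> b i"
  shows "(\<lambda>k. cdist m (x k) (y k)) \<longlonglongrightarrow> cdist m a b"
  unfolding cdist_def L2_set_def by (intro tendsto_intros assms)

text \<open>
  Some minimizing sequence for the distance from \<open>w\<close> to \<open>D\<close> has a coordinatewise limit \<open>q\<close>. Letting the
  sequence tend to \<open>q\<close> in the convex combinations with a point \<open>z\<close> of \<open>D\<close> shows that the segment
  from \<open>q\<close> to \<open>z\<close> stays at least as far from \<open>w\<close> as \<open>q\<close>, although \<open>q\<close> need not belong to \<open>D\<close>. The
  first-order condition at \<open>q\<close> says that \<open>w - q\<close> separates.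
\<close>

lemma separating_functional:
  assumes D: "D \<subseteq> Cspace m" "cconvex D" "D \<noteq> {}" and w: "w \<in> Cspace m"
    and d: "d > 0" "\<And>y. y \<in> D \<Longrightarrow> d \<le> cdist m w y"
  obtains u where "u \<in> Cspace m" "cdist m u (\<lambda>i. 0) = 1"
    "\<And>y. y \<in> D \<Longrightarrow> Re (cinner m (\<lambda>i. w i - y i) u) > 0"
proof -
  define \<delta> where "\<delta> = Inf (cdist m w ` D)"
  have bdd: "bdd_below (cdist m w ` D)" by (intro bdd_belowI[of _ 0]) auto
  have \<delta>_le: "\<delta> \<le> cdist m w y" if "y \<in> D" for y
    unfolding \<delta>_def using that bdd by (intro cInf_lower) auto
  have \<delta>: "\<delta> > 0"
    unfolding \<delta>_def using d D(3) by (intro order.strict_trans2[OF d(1)] cInf_greatest) auto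
  have "\<exists>y\<in>D. cdist m w y < \<delta> + 1 / real (Suc k)" for k
    using cInf_lessD[of "cdist m w ` D" "\<delta> + 1 / real (Suc k)"] D(3) by (auto simp: \<delta>_def)
  then obtain y where y: "\<And>k. y k \<in> D" "\<And>k. cdist m w (y k) < \<delta> + 1 / real (Suc k)"
    by metis
  have "cdist m w (y k) \<le> \<delta> + 1" for k
    using y(2)[of k] by (rule less_imp_le[OF order.strict_trans2]) simp
  then obtain q \<sigma> where q: "q \<in> Cspace m" "strict_mono \<sigma>" "\<And>i. (\<lambda>k. y (\<sigma> k) i) \<longlonglongrightarrow> q i"
    using bounded_cdist_convergent_subseq[of y m w "\<delta> + 1"] y(1) D(1) by blast
  define a where "a = (\<lambda>i. w i - q i)"
  have far: "\<delta> \<le> cdist m w (\<lambda>i. of_real (1 - t) * q i + of_real t * z i)" if "z \<in> D" "t \<in> {0..1}" for z t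
  proof (rule LIMSEQ_le_const)
    show "(\<lambda>k. cdist m w (\<lambda>i. of_real (1 - t) * y (\<sigma> k) i + of_real t * z i))
        \<longlonglongrightarrow> cdist m w (\<lambda>i. of_real (1 - t) * q i + of_real t * z i)"
      by (intro tendsto_cdist tendsto_intros q(3))
    show "\<exists>N. \<forall>n\<ge>N. \<delta> \<le> cdist m w (\<lambda>i. of_real (1 - t) * y (\<sigma> n) i + of_real t * z i)"
      using D(2) y(1) that unfolding cconvex_def by (intro exI allI impI \<delta>_le) blast
  qed
  have "cdist m w q \<le> \<delta>"
  proof (rule LIMSEQ_le)
    show "(\<lambda>k. cdist m w (y (\<sigma> k))) \<longlonglongrightarrow> cdist m w q" by (intro tendsto_cdist tendsto_intros q(3))
    show "(\<lambda>k. \<delta> + 1 / real (Suc (\<sigma> k))) \<longlonglongrightarrow> \<delta>"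
      using LIMSEQ_subseq_LIMSEQ[OF LIMSEQ_inverse_real_of_nat_add[of \<delta>] q(2)]
      by (simp add: o_def inverse_eq_divide)
    show "\<exists>N. \<forall>n\<ge>N. cdist m w (y (\<sigma> n)) \<le> \<delta> + 1 / real (Suc (\<sigma> n))"
      using y(2) less_imp_le by blast
  qed
  then have a\<delta>: "cdist m a (\<lambda>i. 0) = \<delta>"
    using far[of "y 0" 0] y(1) by (simp add: a_def cdist_def)
  have pos: "Re (cinner m (\<lambda>i. w i - z i) a) > 0" if z: "z \<in> D" for z
  proof -
    define e where "e = (\<lambda>i. z i - q i)"
    have "Re (cinner m e a) \<le> 0"
    proof (rule ccontr)
      assume "\<not> Re (cinner m e a) \<le> 0"
      then have c: "Re (cinner m e a) > 0" by simp
      define N where "N = (cdist m e (\<lambda>i. 0))\<^sup>2"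
      have key: "2 * Re (cinner m e a) \<le> t * N" if t: "0 < t" "t \<le> 1" for t
      proof -
        have "\<delta> \<le> cdist m a (\<lambda>i. of_real t * e i)"
          using far[OF z, of t] t by (simp add: a_def e_def cdist_def algebra_simps)
        then have "\<delta>\<^sup>2 \<le> (cdist m a (\<lambda>i. of_real t * e i))\<^sup>2" using \<delta> by (intro power_mono) auto
        then have "t * (2 * Re (cinner m e a)) \<le> t * (t * N)"
          unfolding cdist_diff_line a\<delta> N_def by (simp add: power2_eq_square[of t] mult_ac)
        then show ?thesis using t by simp
      qed
      have "((\<lambda>t. t * N) \<longlongrightarrow> 0 * N) (at_right 0)" by (intro tendsto_intros)
      moreover have "\<forall>\<^sub>F t in at_right 0. 2 * Re (cinner m e a) \<le> t * N"
        unfolding eventually_at_right_field using key by (intro exI[of _ 1]) auto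
      ultimately have "2 * Re (cinner m e a) \<le> 0 * N"
        by (rule tendsto_lowerbound) simp
      then show False using c by simp
    qed
    moreover have "cinner m (\<lambda>i. w i - z i) a = cinner m a a - cinner m e a"
      by (simp add: cinner_def a_def e_def algebra_simps flip: sum_subtractf)
    moreover have "Re (cinner m a a) > 0" using \<delta> by (simp add: Re_cinner_self a\<delta>)
    ultimately show ?thesis by simp
  qed
  show thesis
  proof (rule that[of "\<lambda>i. of_real (1 / \<delta>) * a i"])
    show "(\<lambda>i. of_real (1 / \<delta>) * a i) \<in> Cspace m" using w q(1) by (auto simp: Cspace_def a_def)
    show "cdist m (\<lambda>i. of_real (1 / \<delta>) * a i) (\<lambda>i. 0) = 1"
      unfolding cdist_scale a\<delta> using \<delta> by simp
    fix z assume "z \<in> D"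
    have "cinner m (\<lambda>i. w i - z i) (\<lambda>i. of_real (1 / \<delta>) * a i)
        = of_real (1 / \<delta>) * cinner m (\<lambda>i. w i - z i) a"
      unfolding cinner_def sum_distrib_left by (simp add: mult_ac)
    then show "Re (cinner m (\<lambda>i. w i - z i) (\<lambda>i. of_real (1 / \<delta>) * a i)) > 0"
      using pos[OF \<open>z \<in> D\<close>] \<delta> by simp
  qed
qed

section \<open>The linear Harnack bound for a \<open>C\<^sup>2\<close> boundary\<close>

text \<open>
  Let \<open>p\<close> be a nearest point to \<open>z\<close> outside \<open>D\<close>, at distance \<open>s\<close>, and let \<open>\<nu>\<close> be the direction from \<open>p\<close>
  to \<open>z\<close>. If \<open>s\<close> is smaller than the interior ball radius \<open>\<epsilon>\<close>, then \<open>z\<close> lies on the radius from \<open>p\<close> to the centre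
  \<open>p + \<epsilon> \<nu>\<close> of a ball of radius \<open>\<epsilon>\<close> in \<open>D\<close>, at distance \<open>\<epsilon> - s\<close> from the centre, and Harnack's inequality
  on that ball loses only the factor \<open>s / (2 \<epsilon> - s)\<close>. Otherwise the general bound with radius \<open>\<epsilon>\<close> is
  a constant, and \<open>r\<close> is bounded in terms of the size of \<open>D\<close>.
\<close>

lemma harnack_C2:
  fixes D :: "(complex^'n) set"
  assumes D: "convex D" "bounded D" "open D" "C2_boundary D" "a \<in> D"
  obtains C where "C > 0"
    "\<And>F z r. halfplane_holomorphic F D \<Longrightarrow> 0 < r \<Longrightarrow> ball z r \<subseteq> D \<Longrightarrow> C * r * Re (F a) \<le> Re (F z)"
proof -
  obtain \<alpha> C0 where C0: "C0 > 0"
    "\<And>F z r. halfplane_holomorphic F D \<Longrightarrow> 0 < r \<Longrightarrow> ball z r \<subseteq> D \<Longrightarrow> C0 * r powr \<alpha> * Re (F a) \<le> Re (F z)"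
    using harnack_convex[OF D(1-3,5)] by metis
  obtain \<epsilon> where \<epsilon>: "\<epsilon> > 0"
    "\<And>p \<nu> s. p \<in> frontier D \<Longrightarrow> norm \<nu> = 1 \<Longrightarrow> s > 0 \<Longrightarrow>
        ball (p + s *\<^sub>R \<nu>) s \<subseteq> D \<Longrightarrow> ball (p + \<epsilon> *\<^sub>R \<nu>) \<epsilon> \<subseteq> D"
    using C2_boundary_interior_ball[OF D(3,2,4)] by metis
  obtain M where M: "M > 0" "D \<subseteq> cball 0 M"
    using D(2) unfolding bounded_pos by (auto simp: subset_iff)
  define c where "c = C0 * \<epsilon> powr \<alpha>"
  have c: "c > 0" using C0 \<epsilon> by (simp add: c_def)
  define C where "C = min (c / M) (c / (2 * \<epsilon>))"
  show thesis
  proof (rule that)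
    show "C > 0" using c M \<epsilon> by (simp add: C_def)
    fix F :: "complex^'n \<Rightarrow> complex" and z r assume F: "halfplane_holomorphic F D" and r: "0 < r" "ball z r \<subseteq> D"
    have Fa: "Re (F a) > 0" using F D(5) by (auto simp: halfplane_holomorphic_def)
    have "- D \<noteq> {}" using D(2) not_bounded_UNIV by (metis Compl_empty_eq double_complement)
    then obtain p where p: "p \<in> - D" "infdist z (- D) = dist z p"
      using infdist_attains_inf[of "- D" z] D(3) by (auto simp: closed_Compl)
    define s where "s = dist z p"
    have rs: "r \<le> s" using r p(1) by (force simp: s_def)
    then have s: "s > 0" using r by simp
    have zs: "ball z s \<subseteq> D"
    proof
      fix x assume x: "x \<in> ball z s"
      show "x \<in> D"
      proof (rule ccontr)
        assume "x \<notin> D"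
        then have "infdist z (- D) \<le> dist z x" by (intro infdist_le) simp
        with x p(2) show False by (simp add: s_def)
      qed
    qed
    show "C * r * Re (F a) \<le> Re (F z)"
    proof (cases "\<epsilon> \<le> s")
      case True
      then have "ball z \<epsilon> \<subseteq> D" using zs subset_ball[OF True, of z] by blast
      then have "c * Re (F a) \<le> Re (F z)" unfolding c_def by (rule C0(2)[OF F \<epsilon>(1)])
      moreover have "r \<le> M"
      proof -
        have "ball z r \<subseteq> cball 0 M" using r M by blast
        then show ?thesis using r(1) zero_le_dist[of z 0] unfolding ball_subset_cball_iff by linarith
      qed
      then have "C * r \<le> c / M * M" using \<open>C > 0\<close> r M by (intro mult_mono) (auto simp: C_def)
      then have "C * r \<le> c" using M by simp
      then have "C * r * Re (F a) \<le> c * Re (F a)" using Fa by (intro mult_right_mono) auto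
      ultimately show ?thesis by simp
    next
      case False
      define \<nu> where "\<nu> = (1 / s) *\<^sub>R (z - p)"
      have \<nu>: "norm \<nu> = 1" using s by (simp add: \<nu>_def s_def dist_norm)
      have z: "z = p + s *\<^sub>R \<nu>" using s by (simp add: \<nu>_def)
      have "p \<in> closure (ball z s)" using s by (simp add: s_def)
      then have "p \<in> closure D" using closure_mono[OF zs] by blast
      then have "p \<in> frontier D" using p(1) D(3) by (simp add: frontier_def interior_open)
      define w where "w = p + \<epsilon> *\<^sub>R \<nu>"
      have w: "ball w \<epsilon> \<subseteq> D"
        unfolding w_def using \<epsilon>(2)[OF \<open>p \<in> frontier D\<close> \<nu> s] zs z by simp
      have "w - z = (\<epsilon> - s) *\<^sub>R \<nu>" by (simp add: w_def z algebra_simps)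
      then have wz: "dist w z = \<epsilon> - s" using \<nu> False by (simp add: dist_norm)
      have "(\<epsilon> - dist w z) / (\<epsilon> + dist w z) * Re (F w) \<le> Re (F z)"
        using wz s by (intro harnack_ball[OF F w]) simp
      then have *: "s / (2 * \<epsilon> - s) * Re (F w) \<le> Re (F z)" by (simp add: wz)
      have Fw: "c * Re (F a) \<le> Re (F w)" unfolding c_def by (rule C0(2)[OF F \<epsilon>(1) w])
      have "C * r \<le> c / (2 * \<epsilon>) * s"
        using rs r c \<epsilon>(1) by (intro mult_mono) (auto simp: C_def)
      then have "C * r * Re (F a) \<le> s / (2 * \<epsilon>) * (c * Re (F a))"
        using mult_right_mono[of "C * r" "c / (2 * \<epsilon>) * s" "Re (F a)"] Fa by (simp add: mult_ac)
      also have "\<dots> \<le> s / (2 * \<epsilon> - s) * Re (F w)"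
        using Fw s False \<epsilon>(1) c Fa by (intro mult_mono divide_left_mono) auto
      finally show ?thesis using * by simp
    qed
  qed
qed

section \<open>From scalar functions to maps into convex sets\<close>

lemma holomorphic_several_cinner:
  assumes \<phi>: "\<And>i. i < m \<Longrightarrow> holomorphic_several (\<lambda>z. \<phi> z i) D"
  shows "holomorphic_several (\<lambda>z. cinner m (\<lambda>i. w i - \<phi> z i) u) D"
  unfolding holomorphic_several_def
proof
  fix z assume z: "z \<in> D"
  have "\<forall>i. \<exists>L. i < m \<longrightarrow> ((\<lambda>z. \<phi> z i) has_derivative L) (at z) \<and> Vector_Spaces.linear (*s) (*) L"
    using \<phi> z unfolding holomorphic_several_def by blast
  then obtain L where L: "\<And>i. i < m \<Longrightarrow> ((\<lambda>z. \<phi> z i) has_derivative L i) (at z)"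
    "\<And>i. i < m \<Longrightarrow> Vector_Spaces.linear (*s) (*) (L i)"
    by metis
  let ?L = "\<lambda>h. \<Sum>i<m. - L i h * cnj (u i)"
  have "((\<lambda>z. cinner m (\<lambda>i. w i - \<phi> z i) u) has_derivative ?L) (at z)"
    unfolding cinner_def
    by (intro has_derivative_sum) (auto intro!: derivative_eq_intros L(1))
  moreover have "Vector_Spaces.linear (*s) (*) ?L"
  proof -
    have "L i (x + y) = L i x + L i y" "L i (c *s x) = c * L i x" if "i < m" for i x y c
      using L(2)[OF that] unfolding Vector_Spaces.linear_iff by blast+
    then show ?thesis
      unfolding Vector_Spaces.linear_iff
      by (simp add: vec.vector_space_axioms vector_space_over_itself.vector_space_axioms
          sum_distrib_left algebra_simps flip: sum_subtractf sum.distrib sum_negf)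
  qed
  ultimately show "\<exists>L. ((\<lambda>z. cinner m (\<lambda>i. w i - \<phi> z i) u) has_derivative L) (at z)
      \<and> Vector_Spaces.linear (*s) (*) L" by blast
qed

text \<open>
  Moving a point \<open>w\<close> outside \<open>D2\<close> away from \<open>b\<close> produces a positive distance to \<open>D2\<close>, even when \<open>w\<close>
  lies on the boundary. If \<open>y\<close> in \<open>D2\<close> were too close to \<open>w + s (w - b)\<close>, then a point \<open>b'\<close> of the ball
  around \<open>b\<close> could be chosen such that \<open>w\<close> is the convex combination \<open>(y + s b') / (1 + s)\<close>,
  forcing \<open>w\<close> into \<open>D2\<close>.
\<close>

lemma outward_shift_far:
  assumes D2: "D2 \<subseteq> Cspace m" "cconvex D2" and w: "w \<in> Cspace m" "w \<notin> D2" and b: "b \<in> Cspace m"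
    and \<rho>: "\<And>x. x \<in> Cspace m \<Longrightarrow> cdist m b x < \<rho> \<Longrightarrow> x \<in> D2" and s: "s > 0" and y: "y \<in> D2"
  shows "s * \<rho> \<le> cdist m (\<lambda>i. w i + of_real s * (w i - b i)) y"
proof (rule ccontr)
  assume less: "\<not> ?thesis"
  define v where "v = (\<lambda>i. w i + of_real s * (w i - b i) - y i)"
  define b' where "b' = (\<lambda>i. b i + of_real (1 / s) * v i)"
  have "y \<in> Cspace m" using y D2 by auto
  have "cdist m v (\<lambda>i. 0) < s * \<rho>" using less by (simp add: v_def cdist_def)
  moreover have "cdist m b b' = cdist m (\<lambda>i. of_real (1 / s) * v i) (\<lambda>i. 0)"
    by (simp add: b'_def cdist_def)
  then have "cdist m b b' = cdist m v (\<lambda>i. 0) / s"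
    unfolding cdist_scale using s by simp
  ultimately have "cdist m b b' < \<rho>" using s by (simp add: pos_divide_less_eq mult.commute)
  moreover have "b' \<in> Cspace m"
    using b w \<open>y \<in> Cspace m\<close> by (simp add: b'_def v_def Cspace_def)
  ultimately have "b' \<in> D2" by (intro \<rho>)
  define t where "t = s / (1 + s)"
  have t: "t \<in> {0..1}" "1 - t = 1 / (1 + s)" using s by (auto simp: t_def field_simps)
  have "(\<lambda>i. of_real (1 - t) * y i + of_real t * b' i) \<in> D2"
    using D2(2) y \<open>b' \<in> D2\<close> t(1) unfolding cconvex_def by blast
  moreover have "(\<lambda>i. of_real (1 - t) * y i + of_real t * b' i) = w"
  proof
    fix i
    have "complex_of_real s \<noteq> 0" using s by simp
    have "complex_of_real (1 + s) \<noteq> 0" using s by (simp only: of_real_eq_0_iff)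
    then have "of_real (1 - t) * y i + of_real t * b' i = (y i + of_real s * b' i) / of_real (1 + s)"
      unfolding t(2) by (simp add: t_def add_divide_distrib)
    also have "of_real s * b' i = of_real s * b i + v i"
      using \<open>complex_of_real s \<noteq> 0\<close> by (simp add: b'_def distrib_left)
    also have "y i + \<dots> = of_real (1 + s) * w i" by (simp add: v_def algebra_simps)
    finally show "of_real (1 - t) * y i + of_real t * b' i = w i"
      using \<open>complex_of_real (1 + s) \<noteq> 0\<close> by simp
  qed
  ultimately show False using w by simp
qed

text \<open>
  This is where the geometry of \<open>D2\<close> enters. Separate the shifted point \<open>w' = w + s (w - b)\<close> from \<open>D2\<close>
  by a unit vector \<open>u\<close> and apply the Harnack inequality to \<open>F z = \<langle>w' - \<phi> z, u\<rangle>\<close>. The point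
  \<open>b + Re (F a) u\<close> lies on the hyperplane through \<open>w'\<close> orthogonal to \<open>u\<close>, hence outside \<open>D2\<close>, so \<open>Re (F a) \<ge> \<delta>\<close>. The
  shift costs \<open>s |w - b|\<close>, which is arbitrarily small.
\<close>

lemma harnack_transfer:
  assumes H: "\<And>F. halfplane_holomorphic F D \<Longrightarrow> c * Re (F a) \<le> Re (F z)" and c: "c \<ge> 0" and az: "a \<in> D" "z \<in> D"
    and D2: "openin (ctop m) D2" "cconvex D2" and \<phi>: "holomorphic_map m \<phi> D D2"
    and w: "w \<in> Cspace m - D2" and \<delta>: "\<And>x. x \<in> Cspace m - D2 \<Longrightarrow> \<delta> \<le> cdist m (\<phi> a) x"
  shows "c * \<delta> \<le> cdist m (\<phi> z) w"
proof (rule field_le_epsilon)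
  fix e :: real assume e: "e > 0"
  interpret Metric_space "Cspace m" "cdist m" by (rule Metric_space_Cspace)
  define b where "b = \<phi> a"
  have \<phi>D: "\<phi> x \<in> D2" if "x \<in> D" for x using \<phi> that by (auto simp: holomorphic_map_def)
  have D2C: "D2 \<subseteq> Cspace m" using D2(1) openin_mtopology by (simp add: ctop_def)
  have bD: "b \<in> D2" using \<phi>D az by (simp add: b_def)
  then obtain \<rho> where \<rho>: "\<rho> > 0" "mball b \<rho> \<subseteq> D2"
    using D2(1) openin_mtopology by (auto simp: ctop_def)
  have \<rho>': "x \<in> D2" if "x \<in> Cspace m" "cdist m b x < \<rho>" for x
    using that bD D2C by (intro subsetD[OF \<rho>(2)]) (auto simp: in_mball)
  define s where "s = e / (1 + cdist m w b)"
  have den: "1 + cdist m w b > 0" by (simp add: add_pos_nonneg)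
  have s: "s > 0" using e den by (simp add: s_def)
  have se: "s * cdist m w b \<le> e"
  proof -
    have "s * cdist m w b \<le> s * (1 + cdist m w b)" using s by (intro mult_left_mono) auto
    also have "\<dots> = e" using den by (simp add: s_def)
    finally show ?thesis .
  qed
  define w' where "w' = (\<lambda>i. w i + of_real s * (w i - b i))"
  have w'C: "w' \<in> Cspace m" using w bD D2C by (auto simp: w'_def Cspace_def)
  have "s * \<rho> \<le> cdist m w' y" if "y \<in> D2" for y
    unfolding w'_def using w bD D2C \<rho>' s that
    by (intro outward_shift_far[OF D2C D2(2)]) auto
  then obtain u where u: "u \<in> Cspace m" "cdist m u (\<lambda>i. 0) = 1"
    "\<And>y. y \<in> D2 \<Longrightarrow> Re (cinner m (\<lambda>i. w' i - y i) u) > 0"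
    using separating_functional[OF D2C D2(2) _ w'C, of "s * \<rho>"] s \<rho>(1) bD by (metis empty_iff mult_pos_pos)
  define F where "F = (\<lambda>z. cinner m (\<lambda>i. w' i - \<phi> z i) u)"
  have F: "halfplane_holomorphic F D"
    unfolding halfplane_holomorphic_def F_def
    using \<phi> u(3) \<phi>D by (auto intro!: holomorphic_several_cinner simp: holomorphic_map_def)
  define t where "t = Re (F a)"
  have "\<delta> \<le> t"
  proof -
    define v where "v = (\<lambda>i. b i + of_real t * u i)"
    have "cinner m (\<lambda>i. w' i - v i) u = F a - of_real t * cinner m u u"
      unfolding cinner_def F_def v_def b_def sum_distrib_left
      by (simp add: algebra_simps flip: sum_subtractf)
    then have "Re (cinner m (\<lambda>i. w' i - v i) u) = 0"
      using u(2) by (simp add: Re_cinner_self t_def)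
    then have "v \<notin> D2" using u(3) by force
    moreover have "v \<in> Cspace m" using u(1) bD D2C by (auto simp: v_def Cspace_def)
    ultimately have "\<delta> \<le> cdist m b v" using \<delta> by (simp add: b_def)
    also have "\<dots> = cdist m (\<lambda>i. of_real t * u i) (\<lambda>i. 0)" by (simp add: v_def cdist_def)
    also have "\<dots> = \<bar>t\<bar>" unfolding cdist_scale u(2) by simp
    also have "\<bar>t\<bar> = t" using F az(1) unfolding t_def halfplane_holomorphic_def by (intro abs_of_pos) auto
    finally show ?thesis .
  qed
  then have "c * \<delta> \<le> c * t" using c by (rule mult_left_mono)
  also have "\<dots> \<le> Re (F z)" unfolding t_def by (rule H[OF F])
  also have "\<dots> \<le> cdist m w' (\<phi> z)"
    using Re_cinner_le[of m "\<lambda>i. w' i - \<phi> z i" u] by (simp add: F_def u(2)) (simp add: cdist_def)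
  also have "\<dots> \<le> cdist m w' w + cdist m w (\<phi> z)"
    using w w'C \<phi>D[OF az(2)] D2C by (intro triangle) auto
  also have "cdist m w' w = s * cdist m w b"
  proof -
    have "cdist m w' w = cdist m (\<lambda>i. of_real s * (w i - b i)) (\<lambda>i. 0)" by (simp add: w'_def cdist_def)
    also have "\<dots> = \<bar>s\<bar> * cdist m (\<lambda>i. w i - b i) (\<lambda>i. 0)" by (rule cdist_scale)
    finally show ?thesis using s by (simp add: cdist_def)
  qed
  finally show "c * \<delta> \<le> cdist m (\<phi> z) w + e" using se by (simp add: commute)
qed

lemma edist_transfer:
  fixes D :: "(complex^'n) set"
  assumes H: "\<And>F z. halfplane_holomorphic F D \<Longrightarrow> ball z r \<subseteq> D \<Longrightarrow> c * Re (F a) \<le> Re (F z)" and c: "c \<ge> 0" and a: "a \<in> D"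
    and D2: "openin (ctop m) D2" "cconvex D2" and \<phi>: "holomorphic_map m \<phi> D D2"
  shows "ennreal c * edist_sets (cdist m) {\<phi> a} (Cspace m - D2)
    \<le> edist_sets (cdist m) (\<phi> ` {z\<in>D. edist_sets dist {z} (- D) \<ge> ennreal r}) (Cspace m - D2)"
proof -
  have "ennreal c * edist_sets (cdist m) {\<phi> a} (Cspace m - D2) \<le> ennreal (cdist m (\<phi> z) w)"
    if z: "z \<in> D" "edist_sets dist {z} (- D) \<ge> ennreal r" and w: "w \<in> Cspace m - D2" for z w
  proof -
    let ?X = "edist_sets (cdist m) {\<phi> a} (Cspace m - D2)"
    have le: "?X \<le> ennreal (cdist m (\<phi> a) x)" if "x \<in> Cspace m - D2" for x
      unfolding edist_sets_def using that by (auto intro: INF_lower)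
    \<comment> \<open>The point \<open>w\<close> makes the infimum finite, so the real inequality can be used.\<close>
    have X: "?X = ennreal (enn2real ?X)"
      using le[OF w] by (metis ennreal_enn2real ennreal_less_top le_less_trans)
    have ball: "ball z r \<subseteq> D"
    proof
      fix x assume x: "x \<in> ball z r"
      show "x \<in> D"
      proof (rule ccontr)
        assume "x \<notin> D"
        then have "edist_sets dist {z} (- D) \<le> ennreal (dist z x)"
          unfolding edist_sets_def by (auto intro: INF_lower)
        then have "ennreal r \<le> ennreal (dist z x)" using z(2) by (rule order_trans[rotated])
        then show False using x by simp
      qed
    qed
    have "c * enn2real ?X \<le> cdist m (\<phi> z) w"
    proof (rule harnack_transfer[OF H c a z(1) D2 \<phi> w])
      show "ball z r \<subseteq> D" by (rule ball)
      show "enn2real ?X \<le> cdist m (\<phi> a) x" if "x \<in> Cspace m - D2" for x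
        using le[OF that] X by (metis cdist_nonneg ennreal_le_iff)
    qed
    then have "ennreal c * ennreal (enn2real ?X) \<le> ennreal (cdist m (\<phi> z) w)"
      using c by (simp add: ennreal_leI flip: ennreal_mult)
    then show ?thesis by (simp flip: X)
  qed
  then show ?thesis
    unfolding edist_sets_def[of "cdist m" "\<phi> ` _"] by (intro INF_greatest) auto
qed

section \<open>The distance estimate\<close>

theorem theorem1p2:
  fixes D1 :: "(complex^'n) set"
  assumes "bounded D1" and "open D1" and "convex D1"
  shows "(\<exists>\<alpha>::real. \<alpha> \<ge> 1 \<and> (\<forall>a\<in>D1. \<exists>C::real. C > 0 \<and>
      (\<forall>(m::nat) D2 b (\<phi> :: complex^'n \<Rightarrow> nat \<Rightarrow> complex) (r::real).
         openin (ctop m) D2 \<longrightarrow> cconvex D2 \<longrightarrow> b \<in> D2 \<longrightarrow>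
         holomorphic_map m \<phi> D1 D2 \<longrightarrow> \<phi> a = b \<longrightarrow> r > 0 \<longrightarrow>
         edist_sets (cdist m) (\<phi> ` {z\<in>D1. edist_sets dist {z} (- D1) \<ge> ennreal r}) (Cspace m - D2)
           \<ge> ennreal C * edist_sets (cdist m) {b} (Cspace m - D2) * ennreal (r powr \<alpha>)))) \<and>
    (C2_boundary D1 \<longrightarrow> (\<forall>a\<in>D1. \<exists>C::real. C > 0 \<and>
      (\<forall>(m::nat) D2 b (\<phi> :: complex^'n \<Rightarrow> nat \<Rightarrow> complex) (r::real).
         openin (ctop m) D2 \<longrightarrow> cconvex D2 \<longrightarrow> b \<in> D2 \<longrightarrow>
         holomorphic_map m \<phi> D1 D2 \<longrightarrow> \<phi> a = b \<longrightarrow> r > 0 \<longrightarrow>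
         edist_sets (cdist m) (\<phi> ` {z\<in>D1. edist_sets dist {z} (- D1) \<ge> ennreal r}) (Cspace m - D2)
           \<ge> ennreal C * edist_sets (cdist m) {b} (Cspace m - D2) * ennreal r)))"
proof -
  have conclude: "ennreal C * edist_sets (cdist m) {b} (Cspace m - D2) * ennreal x
      \<le> edist_sets (cdist m) (\<phi> ` {z\<in>D1. edist_sets dist {z} (- D1) \<ge> ennreal r}) (Cspace m - D2)"
    if "\<And>F z. halfplane_holomorphic F D1 \<Longrightarrow> ball z r \<subseteq> D1 \<Longrightarrow> C * x * Re (F a) \<le> Re (F z)" "C > 0" "x \<ge> 0" "a \<in> D1"
      "openin (ctop m) D2" "cconvex D2" "holomorphic_map m \<phi> D1 D2" "\<phi> a = b"
    for C x r a b m D2 and \<phi> :: "complex^'n \<Rightarrow> nat \<Rightarrow> complex"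
  proof -
    have "ennreal C * edist_sets (cdist m) {b} (Cspace m - D2) * ennreal x
        = ennreal (C * x) * edist_sets (cdist m) {\<phi> a} (Cspace m - D2)"
      using that by (simp add: ennreal_mult mult_ac)
    also have "\<dots> \<le> edist_sets (cdist m) (\<phi> ` {z\<in>D1. edist_sets dist {z} (- D1) \<ge> ennreal r}) (Cspace m - D2)"
      using that by (intro edist_transfer) auto
    finally show ?thesis .
  qed
  show ?thesis
  proof (intro conjI impI)
    show "\<exists>\<alpha>::real. \<alpha> \<ge> 1 \<and> (\<forall>a\<in>D1. \<exists>C::real. C > 0 \<and>
      (\<forall>(m::nat) D2 b (\<phi> :: complex^'n \<Rightarrow> nat \<Rightarrow> complex) (r::real).
         openin (ctop m) D2 \<longrightarrow> cconvex D2 \<longrightarrow> b \<in> D2 \<longrightarrow>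
         holomorphic_map m \<phi> D1 D2 \<longrightarrow> \<phi> a = b \<longrightarrow> r > 0 \<longrightarrow>
         edist_sets (cdist m) (\<phi> ` {z\<in>D1. edist_sets dist {z} (- D1) \<ge> ennreal r}) (Cspace m - D2)
           \<ge> ennreal C * edist_sets (cdist m) {b} (Cspace m - D2) * ennreal (r powr \<alpha>)))"
    proof (cases "D1 = {}")
      case True
      then show ?thesis by (intro exI[of _ 1]) simp
    next
      case False
      then obtain a0 where a0: "a0 \<in> D1" by blast
      then obtain R where R: "R > 0" "ball a0 R \<subseteq> D1"
        using assms(2) open_contains_ball by blast
      \<comment> \<open>The exponent has to be chosen before \<open>a\<close>, so it is taken at a fixed base point \<open>a0\<close>;
          the bound at \<open>a0\<close> relative to \<open>a\<close> then enters \<open>C\<close>.\<close>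
      obtain \<alpha> C0 where C0: "\<alpha> \<ge> 1" "C0 > 0"
        "\<And>F z r. halfplane_holomorphic F D1 \<Longrightarrow> 0 < r \<Longrightarrow> ball z r \<subseteq> D1 \<Longrightarrow> C0 * r powr \<alpha> * Re (F a0) \<le> Re (F z)"
        using harnack_convex[OF assms(3,1,2) a0] by metis
      show ?thesis
      proof (rule exI[of _ \<alpha>], intro conjI ballI C0(1))
        fix a assume a: "a \<in> D1"
        obtain \<beta> C1 where C1: "C1 > 0"
          "\<And>F z r. halfplane_holomorphic F D1 \<Longrightarrow> 0 < r \<Longrightarrow> ball z r \<subseteq> D1 \<Longrightarrow> C1 * r powr \<beta> * Re (F a) \<le> Re (F z)"
          using harnack_convex[OF assms(3,1,2) a] by metis
        define C where "C = C0 * (C1 * R powr \<beta>)"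
        have "C > 0" using C0 C1 R by (simp add: C_def)
        moreover have "C * r powr \<alpha> * Re (F a) \<le> Re (F z)"
          if "halfplane_holomorphic F D1" "0 < r" "ball z r \<subseteq> D1" for F z r
        proof -
          have "C * r powr \<alpha> * Re (F a) = C0 * r powr \<alpha> * (C1 * R powr \<beta> * Re (F a))"
            by (simp add: C_def)
          also have "\<dots> \<le> C0 * r powr \<alpha> * Re (F a0)"
            using C0(2) C1(2)[OF that(1) R] by (intro mult_left_mono) auto
          also have "\<dots> \<le> Re (F z)" by (rule C0(3)[OF that])
          finally show ?thesis .
        qed
        ultimately show "\<exists>C::real. C > 0 \<and>
          (\<forall>(m::nat) D2 b (\<phi> :: complex^'n \<Rightarrow> nat \<Rightarrow> complex) (r::real).
             openin (ctop m) D2 \<longrightarrow> cconvex D2 \<longrightarrow> b \<in> D2 \<longrightarrow>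
             holomorphic_map m \<phi> D1 D2 \<longrightarrow> \<phi> a = b \<longrightarrow> r > 0 \<longrightarrow>
             edist_sets (cdist m) (\<phi> ` {z\<in>D1. edist_sets dist {z} (- D1) \<ge> ennreal r}) (Cspace m - D2)
               \<ge> ennreal C * edist_sets (cdist m) {b} (Cspace m - D2) * ennreal (r powr \<alpha>))"
          using a by (intro exI[of _ C] conjI allI impI conclude) auto
      qed
    qed
  next
    assume C2: "C2_boundary D1"
    show "\<forall>a\<in>D1. \<exists>C::real. C > 0 \<and>
      (\<forall>(m::nat) D2 b (\<phi> :: complex^'n \<Rightarrow> nat \<Rightarrow> complex) (r::real).
         openin (ctop m) D2 \<longrightarrow> cconvex D2 \<longrightarrow> b \<in> D2 \<longrightarrow>
         holomorphic_map m \<phi> D1 D2 \<longrightarrow> \<phi> a = b \<longrightarrow> r > 0 \<longrightarrow>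
         edist_sets (cdist m) (\<phi> ` {z\<in>D1. edist_sets dist {z} (- D1) \<ge> ennreal r}) (Cspace m - D2)
           \<ge> ennreal C * edist_sets (cdist m) {b} (Cspace m - D2) * ennreal r)"
    proof
      fix a assume a: "a \<in> D1"
      obtain C where "C > 0"
        "\<And>F z r. halfplane_holomorphic F D1 \<Longrightarrow> 0 < r \<Longrightarrow> ball z r \<subseteq> D1 \<Longrightarrow> C * r * Re (F a) \<le> Re (F z)"
        using harnack_C2[OF assms(3,1,2) C2 a] by metis
      then show "\<exists>C::real. C > 0 \<and>
        (\<forall>(m::nat) D2 b (\<phi> :: complex^'n \<Rightarrow> nat \<Rightarrow> complex) (r::real).
           openin (ctop m) D2 \<longrightarrow> cconvex D2 \<longrightarrow> b \<in> D2 \<longrightarrow>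
           holomorphic_map m \<phi> D1 D2 \<longrightarrow> \<phi> a = b \<longrightarrow> r > 0 \<longrightarrow>
           edist_sets (cdist m) (\<phi> ` {z\<in>D1. edist_sets dist {z} (- D1) \<ge> ennreal r}) (Cspace m - D2)
             \<ge> ennreal C * edist_sets (cdist m) {b} (Cspace m - D2) * ennreal r)"
        using a by (intro exI[of _ C] conjI allI impI conclude) auto
    qed
  qed
qed

end
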